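(* Let $(\Omega^\bullet,d)$ be a differential calculus on an algebra $A$, and let $V$ be a vector space of derivations on $A$, closed under commutator, for which the interior products and Lie derivatives are well defined. For all $\theta,\phi\in V$, all $n\ge 0$ and all $\omega\in\Omega^n$, $${\cal L}_\phi(\theta\lrcorner\,\omega)=\theta\lrcorner{\cal L}_\phi(\omega)+[\phi,\theta]\lrcorner\,\omega.$$
   Context: $A$ is an associative unital (not necessarily commutative) algebra over a field. A differential calculus on $A$ is a collection of $A$-bimodules $\Omega^n$, $n\ge 0$, with $\Omega^0=A$, with an associative graded product $\Omega^n\times\Omega^m\to\Omega^{n+m}$ extending the bimodule structure, and with a linear signed derivation $d:\Omega^n\to\Omega^{n+1}$, i.e. $d(\omega\tau)=d(\omega)\,\tau+(-1)^{|\omega|}\omega\,d(\tau)$ (where $|\omega|=n$ if $\omega\in\Omega^n$), such that $d^2=0$ and $\Omega^{n+1}$ is spanned by the elements $\omega\,db$ with $\omega\in\Omega^n$, $b\in A$. Everything is purely algebraic (no topology). $V$ is a vector space of linear maps $\theta:A\to A$ with $\theta(ab)=\theta(a)b+a\theta(b)$, closed under the commutator $[\theta,\phi]=\theta\phi-\phi\theta$. Interior product: for $\theta\in V$, $\theta\lrcorner:\Omega^{n+1}\to\Omega^n$ is the linear map determined by $\theta\lrcorner a=0$ for $a\in\Omega^0=A$, $\theta\lrcorner da=\theta(a)$, and $\theta\lrcorner(\omega\tau)=(\theta\lrcorner\,\omega)\tau+(-1)^{|\omega|}\omega(\theta\lrcorner\tau)$. Lie derivative: for $\theta\in V$, ${\cal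 L}_\theta:\Omega^n\to\Omega^n$ is the linear map determined by ${\cal L}_\theta(a)=\theta(a)$ for $a\in\Omega^0=A$, ${\cal L}_\theta(da)=d(\theta(a))$, and ${\cal L}_\theta(\omega\tau)={\cal L}_\theta(\omega)\tau+\omega{\cal L}_\theta(\tau)$. Standing assumption: for every $\theta\in V$ the maps $\theta\lrcorner$ and ${\cal L}_\theta$ are well defined on all of $\Omega^\bullet$ (i.e. compatible with all relations in the calculus). *)

theory Defs
  imports Complex_Main "HOL-Library.Function_Algebras"
begin

(* The sort {ring, monoid_mult} is used in place of ring_1, whose axiom 0 \<noteq> 1 would
   exclude the zero algebra. *)

locale unital_algebra = vector_space scale
  for scale :: "'k::field \<Rightarrow> 'a::{ring, monoid_mult} \<Rightarrow> 'a" +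
  assumes scale_mult_left: "scale c a * b = scale c (a * b)"
    and scale_mult_right: "a * scale c b = scale c (a * b)"

(* The spaces \<Omega> n are realised inside the total algebra, which is their direct sum and whose
   elements have the type 'w.  The identification of A with \<Omega> 0 is the algebra isomorphism
   \<iota> onto \<Omega> 0; the bimodule actions of A on \<Omega> n are multiplication by \<iota> a on the
   left and on the right. *)

locale differential_calculus =
  A: unital_algebra scaleA + W: unital_algebra scaleW
  for scaleA :: "'k::field \<Rightarrow> 'a::{ring, monoid_mult} \<Rightarrow> 'a"
    and scaleW :: "'k \<Rightarrow> 'w::{ring, monoid_mult} \<Rightarrow> 'w" +
  fixes \<iota> :: "'a \<Rightarrow> 'w" and \<Omega> :: "nat \<Rightarrow> 'w set" and d :: "'w \<Rightarrow> 'w"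
  assumes subspace_forms: "W.subspace (\<Omega> n)"
    and direct_sum:
      "\<exists>!f. finite {n. f n \<noteq> 0} \<and> (\<forall>n. f n \<in> \<Omega> n) \<and> x = (\<Sum>n | f n \<noteq> 0. f n)"
    and mult_forms: "\<omega> \<in> \<Omega> n \<Longrightarrow> \<tau> \<in> \<Omega> m \<Longrightarrow> \<omega> * \<tau> \<in> \<Omega> (n + m)"
    and linear_embed: "Vector_Spaces.linear scaleA scaleW \<iota>"
    and embed_mult: "\<iota> (a * b) = \<iota> a * \<iota> b"
    and embed_one: "\<iota> 1 = 1"
    and bij_embed: "bij_betw \<iota> UNIV (\<Omega> 0)"
    and linear_d: "Vector_Spaces.linear scaleW scaleW d"
    and d_forms: "\<omega> \<in> \<Omega> n \<Longrightarrow> d \<omega> \<in> \<Omega> (Suc n)"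
    and d_mult: "\<omega> \<in> \<Omega> n \<Longrightarrow> \<tau> \<in> \<Omega> m \<Longrightarrow>
      d (\<omega> * \<tau>) = d \<omega> * \<tau> + scaleW ((-1) ^ n) (\<omega> * d \<tau>)"
    and d_d: "d (d \<omega>) = 0"
    and forms_spanned: "\<Omega> (Suc n) = W.span {\<omega> * d (\<iota> b) | \<omega> b. \<omega> \<in> \<Omega> n}"

definition derivation ::
    "('k::field \<Rightarrow> 'a::{ring, monoid_mult} \<Rightarrow> 'a) \<Rightarrow> ('a \<Rightarrow> 'a) \<Rightarrow> bool" where
  "derivation scaleA \<theta> \<longleftrightarrow>
     Vector_Spaces.linear scaleA scaleA \<theta> \<and> (\<forall>a b. \<theta> (a * b) = \<theta> a * b + a * \<theta> b)"

definition commutator :: "('a \<Rightarrow> 'a::ab_group_add) \<Rightarrow> ('a \<Rightarrow> 'a) \<Rightarrow> 'a \<Rightarrow> 'a" where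
  "commutator \<theta> \<phi> = (\<lambda>a. \<theta> (\<phi> a) - \<phi> (\<theta> a))"

definition lie_space_of_derivations ::
    "('k::field \<Rightarrow> 'a::{ring, monoid_mult} \<Rightarrow> 'a) \<Rightarrow> ('a \<Rightarrow> 'a) set \<Rightarrow> bool" where
  "lie_space_of_derivations scaleA V \<longleftrightarrow>
     module.subspace (\<lambda>c \<theta> a. scaleA c (\<theta> a)) V \<and>
     (\<forall>\<theta>\<in>V. derivation scaleA \<theta>) \<and>
     (\<forall>\<theta>\<in>V. \<forall>\<phi>\<in>V. commutator \<theta> \<phi> \<in> V)"

(* Both predicates below determine the map uniquely on every differential calculus
   (is_interior_product_unique and is_lie_derivative_unique), so well-definedness of the
   interior product or Lie derivative is the existence of such a map. *)

definition is_interior_product ::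
    "('k::field \<Rightarrow> 'w::{ring, monoid_mult} \<Rightarrow> 'w) \<Rightarrow> ('a \<Rightarrow> 'w) \<Rightarrow> (nat \<Rightarrow> 'w set) \<Rightarrow>
     ('w \<Rightarrow> 'w) \<Rightarrow> ('a \<Rightarrow> 'a) \<Rightarrow> ('w \<Rightarrow> 'w) \<Rightarrow> bool" where
  "is_interior_product scaleW \<iota> \<Omega> d \<theta> i \<longleftrightarrow>
     Vector_Spaces.linear scaleW scaleW i \<and>
     (\<forall>n. \<forall>\<omega>\<in>\<Omega> (Suc n). i \<omega> \<in> \<Omega> n) \<and>
     (\<forall>a. i (\<iota> a) = 0) \<and>
     (\<forall>a. i (d (\<iota> a)) = \<iota> (\<theta> a)) \<and>
     (\<forall>n m. \<forall>\<omega>\<in>\<Omega> n. \<forall>\<tau>\<in>\<Omega> m.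
        i (\<omega> * \<tau>) = i \<omega> * \<tau> + scaleW ((-1) ^ n) (\<omega> * i \<tau>))"

definition is_lie_derivative ::
    "('k::field \<Rightarrow> 'w::{ring, monoid_mult} \<Rightarrow> 'w) \<Rightarrow> ('a \<Rightarrow> 'w) \<Rightarrow> (nat \<Rightarrow> 'w set) \<Rightarrow>
     ('w \<Rightarrow> 'w) \<Rightarrow> ('a \<Rightarrow> 'a) \<Rightarrow> ('w \<Rightarrow> 'w) \<Rightarrow> bool" where
  "is_lie_derivative scaleW \<iota> \<Omega> d \<theta> L \<longleftrightarrow>
     Vector_Spaces.linear scaleW scaleW L \<and>
     (\<forall>n. \<forall>\<omega>\<in>\<Omega> n. L \<omega> \<in> \<Omega> n) \<and>
     (\<forall>a. L (\<iota> a) = \<iota> (\<theta> a)) \<and>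
     (\<forall>a. L (d (\<iota> a)) = d (\<iota> (\<theta> a))) \<and>
     (\<forall>n m. \<forall>\<omega>\<in>\<Omega> n. \<forall>\<tau>\<in>\<Omega> m. L (\<omega> * \<tau>) = L \<omega> * \<tau> + \<omega> * L \<tau>)"

definition interior_product ::
    "('k::field \<Rightarrow> 'w::{ring, monoid_mult} \<Rightarrow> 'w) \<Rightarrow> ('a \<Rightarrow> 'w) \<Rightarrow> (nat \<Rightarrow> 'w set) \<Rightarrow>
     ('w \<Rightarrow> 'w) \<Rightarrow> ('a \<Rightarrow> 'a) \<Rightarrow> 'w \<Rightarrow> 'w" where
  "interior_product scaleW \<iota> \<Omega> d \<theta> = (THE i. is_interior_product scaleW \<iota> \<Omega> d \<theta> i)"

definition lie_derivative ::
    "('k::field \<Rightarrow> 'w::{ring, monoid_mult} \<Rightarrow> 'w) \<Rightarrow> ('a \<Rightarrow> 'w) \<Rightarrow> (nat \<Rightarrow> 'w set) \<Rightarrow>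
     ('w \<Rightarrow> 'w) \<Rightarrow> ('a \<Rightarrow> 'a) \<Rightarrow> 'w \<Rightarrow> 'w" where
  "lie_derivative scaleW \<iota> \<Omega> d \<theta> = (THE L. is_lie_derivative scaleW \<iota> \<Omega> d \<theta> L)"

context differential_calculus
begin

lemma linear_eq_on_forms:
  assumes f: "Vector_Spaces.linear scaleW scaleW f" and g: "Vector_Spaces.linear scaleW scaleW g"
    and zero: "\<And>a. f (\<iota> a) = g (\<iota> a)"
    and step: "\<And>n \<omega> b. \<omega> \<in> \<Omega> n \<Longrightarrow> f \<omega> = g \<omega> \<Longrightarrow> f (\<omega> * d (\<iota> b)) = g (\<omega> * d (\<iota> b))"
  shows "f = g"
proof
  fix x
  interpret f: Vector_Spaces.linear scaleW scaleW f by (rule f)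
  interpret g: Vector_Spaces.linear scaleW scaleW g by (rule g)
  interpret p: vector_space_pair scaleW scaleW by unfold_locales
  have forms: "f \<omega> = g \<omega>" if "\<omega> \<in> \<Omega> n" for n \<omega>
    using that
  proof (induction n arbitrary: \<omega>)
    case 0
    then obtain a where "\<omega> = \<iota> a" using bij_embed unfolding bij_betw_def by blast
    then show ?case using zero by simp
  next
    case (Suc n)
    then have "\<omega> \<in> W.span {\<omega> * d (\<iota> b) | \<omega> b. \<omega> \<in> \<Omega> n}" by (simp add: forms_spanned)
    then show ?case
      using p.linear_eq_on[OF f g] step Suc.IH by (smt (verit) mem_Collect_eq)
  qed
  obtain h where h: "\<And>n. h n \<in> \<Omega> n" and x: "x = (\<Sum>n | h n \<noteq> 0. h n)"
    using direct_sum[of x] by blast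
  show "f x = g x"
    unfolding x f.sum g.sum using forms[OF h] by simp
qed

lemma d_embed_mem: "d (\<iota> b) \<in> \<Omega> (Suc 0)"
  using bij_embed by (intro d_forms) (auto simp: bij_betw_def)

lemma is_interior_product_unique:
  assumes "is_interior_product scaleW \<iota> \<Omega> d \<theta> i" and "is_interior_product scaleW \<iota> \<Omega> d \<theta> j"
  shows "i = j"
  using assms d_embed_mem unfolding is_interior_product_def
  by (intro linear_eq_on_forms) metis+

lemma is_lie_derivative_unique:
  assumes "is_lie_derivative scaleW \<iota> \<Omega> d \<theta> L" and "is_lie_derivative scaleW \<iota> \<Omega> d \<theta> M"
  shows "L = M"
  using assms d_embed_mem unfolding is_lie_derivative_def
  by (intro linear_eq_on_forms) metis+

end

end

(* Both sides are linear in the form, vanish on A, and transform in the same way under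
   multiplication by d b, where the commutator appears as the difference of \<phi> (\<theta> b) and
   \<theta> (\<phi> b).  Since the forms are spanned by products with exact 1-forms, they agree. *)

theory Submission
  imports Defs
begin

context differential_calculus
begin

text \<open>Uniqueness turns the definite description into any map with the characterising
  properties, so the identity need only be proved for such maps.\<close>

lemma interior_product_eq:
  assumes "is_interior_product scaleW \<iota> \<Omega> d \<theta> i"
  shows "interior_product scaleW \<iota> \<Omega> d \<theta> = i"
  unfolding interior_product_def using assms is_interior_product_unique
  by (intro the_equality) blast+

lemma lie_derivative_eq:
  assumes "is_lie_derivative scaleW \<iota> \<Omega> d \<theta> L"
  shows "lie_derivative scaleW \<iota> \<Omega> d \<theta> = L"
  unfolding lie_derivative_def using assms is_lie_derivative_unique
  by (intro the_equality) blast+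

(* For n = 0 the truncated degree n - 1 is harmless, since then i \<omega> = 0. *)
lemma is_interior_product_mem:
  assumes "is_interior_product scaleW \<iota> \<Omega> d \<theta> i" and "\<omega> \<in> \<Omega> n"
  shows "i \<omega> \<in> \<Omega> (n - 1)"
proof (cases n)
  case 0
  then obtain a where "\<omega> = \<iota> a" using assms(2) bij_embed unfolding bij_betw_def by blast
  then have "i \<omega> = 0" using assms(1) unfolding is_interior_product_def by blast
  then show ?thesis using W.subspace_0[OF subspace_forms] by simp
next
  case (Suc m)
  then show ?thesis using assms unfolding is_interior_product_def by simp
qed

text \<open>The identity is proved on the whole total algebra, since
  \<open>linear_eq_on_forms\<close> compares linear maps there. Taking \<open>j\<close> as an
  arbitrary interior product for the commutator keeps \<open>V\<close> out of the
  computation.\<close>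

lemma lie_derivative_interior_product:
  assumes L: "is_lie_derivative scaleW \<iota> \<Omega> d \<phi> L"
    and i: "is_interior_product scaleW \<iota> \<Omega> d \<theta> i"
    and j: "is_interior_product scaleW \<iota> \<Omega> d (commutator \<phi> \<theta>) j"
  shows "L (i x) = i (L x) + j x"
proof -
  interpret embed: Vector_Spaces.linear scaleA scaleW \<iota> by (rule linear_embed)
  interpret L: Vector_Spaces.linear scaleW scaleW L
    using L unfolding is_lie_derivative_def by blast
  interpret i: Vector_Spaces.linear scaleW scaleW i
    using i unfolding is_interior_product_def by blast
  interpret j: Vector_Spaces.linear scaleW scaleW j
    using j unfolding is_interior_product_def by blast
  note L_props = L[unfolded is_lie_derivative_def]
  note i_props = i[unfolded is_interior_product_def]
  note j_props = j[unfolded is_interior_product_def]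
  have L_embed: "L (\<iota> a) = \<iota> (\<phi> a)" and L_d: "L (d (\<iota> a)) = d (\<iota> (\<phi> a))"
    and i_embed: "i (\<iota> a) = 0" and i_d: "i (d (\<iota> a)) = \<iota> (\<theta> a)"
    and j_embed: "j (\<iota> a) = 0" and j_d: "j (d (\<iota> a)) = \<iota> (commutator \<phi> \<theta> a)" for a
    using L_props i_props j_props by simp_all
  have embed_mem: "\<iota> a \<in> \<Omega> 0" for a
    using bij_embed by (auto simp: bij_betw_def)
  have "(\<lambda>x. L (i x)) = (\<lambda>x. i (L x) + j x)"
  proof (rule linear_eq_on_forms)
    show "Vector_Spaces.linear scaleW scaleW (\<lambda>x. L (i x))"
      by unfold_locales (simp_all add: L.add i.add L.scale i.scale)
    show "Vector_Spaces.linear scaleW scaleW (\<lambda>x. i (L x) + j x)"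
      by unfold_locales
        (simp_all add: L.add i.add j.add L.scale i.scale j.scale W.scale_right_distrib)
    \<comment> \<open>Since \<open>L\<close> sends \<iota> a to \<iota> (\<phi> a), again in degree
      0, every term vanishes.\<close>
    show "L (i (\<iota> a)) = i (L (\<iota> a)) + j (\<iota> a)" for a
      by (simp add: L_embed i_embed j_embed)
  next
    fix n \<omega> b
    assume \<omega>: "\<omega> \<in> \<Omega> n" and IH: "L (i \<omega>) = i (L \<omega>) + j \<omega>"
    \<comment> \<open>As \<open>L\<close> preserves the degree, the product rule of \<open>i\<close>
      has the same sign \<open>(-1) ^ n\<close> at \<open>L \<omega>\<close> as at \<omega>; hence
      \<open>i_mult\<close> is stated for every form of degree \<open>n\<close>.\<close>
    have L\<omega>: "L \<omega> \<in> \<Omega> n" using L_props \<omega> by blast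
    have L_mult: "L (\<sigma> * \<tau>) = L \<sigma> * \<tau> + \<sigma> * L \<tau>"
      if "\<sigma> \<in> \<Omega> p" "\<tau> \<in> \<Omega> q" for \<sigma> \<tau> p q
      using L_props that by blast
    have i_mult: "i (\<sigma> * d (\<iota> a)) = i \<sigma> * d (\<iota> a) + scaleW ((-1) ^ n) (\<sigma> * \<iota> (\<theta> a))"
      if "\<sigma> \<in> \<Omega> n" for \<sigma> a
      using i_props that d_embed_mem by metis
    have j_mult: "j (\<omega> * d (\<iota> b)) =
        j \<omega> * d (\<iota> b) + scaleW ((-1) ^ n) (\<omega> * \<iota> (commutator \<phi> \<theta> b))"
      using j_props \<omega> d_embed_mem by metis
    \<comment> \<open>The product rule of \<open>L\<close> is available only for homogeneous
      factors, so the degree of \<open>i \<omega>\<close> is needed to apply it to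
      \<open>i \<omega> * d (\<iota> b)\<close>.\<close>
    have "L (i (\<omega> * d (\<iota> b))) =
        L (i \<omega>) * d (\<iota> b) + i \<omega> * d (\<iota> (\<phi> b)) +
        scaleW ((-1) ^ n) (L \<omega> * \<iota> (\<theta> b) + \<omega> * \<iota> (\<phi> (\<theta> b)))"
      by (simp add: i_mult[OF \<omega>] L.add L.scale L_mult[OF \<omega> embed_mem]
          L_mult[OF is_interior_product_mem[OF i \<omega>] d_embed_mem] L_embed L_d)
    \<comment> \<open>\<open>IH\<close> accounts for the terms ending in
      \<open>d (\<iota> b)\<close>. Of the rest, \<open>i\<close> contributes \<omega> * \<iota>
      (\<theta> (\<phi> b)) with the sign \<open>(-1) ^ n\<close>, and the commutator in
      \<open>j\<close> replaces it by \<omega> * \<iota> (\<phi> (\<theta> b)).\<close>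
    also have "\<dots> = i (L (\<omega> * d (\<iota> b))) + j (\<omega> * d (\<iota> b))"
      by (simp add: L_mult[OF \<omega> d_embed_mem] L_d i.add i_mult[OF \<omega>] i_mult[OF L\<omega>] j_mult IH
          commutator_def embed.diff W.scale_right_distrib W.scale_right_diff_distrib
          algebra_simps)
    finally show "L (i (\<omega> * d (\<iota> b))) = i (L (\<omega> * d (\<iota> b))) + j (\<omega> * d (\<iota> b))" .
  qed
  then show ?thesis by (rule fun_cong)
qed

end

theorem proposition2p7:
  fixes scaleA :: "'k::field \<Rightarrow> 'a::{ring, monoid_mult} \<Rightarrow> 'a"
    and scaleW :: "'k \<Rightarrow> 'w::{ring, monoid_mult} \<Rightarrow> 'w"
    and \<iota> :: "'a \<Rightarrow> 'w" and \<Omega> :: "nat \<Rightarrow> 'w set" and d :: "'w \<Rightarrow> 'w"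
    and V :: "('a \<Rightarrow> 'a) set" and \<theta> \<phi> :: "'a \<Rightarrow> 'a" and n :: nat and \<omega> :: 'w
  assumes "differential_calculus scaleA scaleW \<iota> \<Omega> d"
    and "lie_space_of_derivations scaleA V"
    and "\<forall>\<psi>\<in>V. \<exists>i. is_interior_product scaleW \<iota> \<Omega> d \<psi> i"
    and "\<forall>\<psi>\<in>V. \<exists>L. is_lie_derivative scaleW \<iota> \<Omega> d \<psi> L"
    and "\<theta> \<in> V" and "\<phi> \<in> V" and "\<omega> \<in> \<Omega> n"
  shows "lie_derivative scaleW \<iota> \<Omega> d \<phi> (interior_product scaleW \<iota> \<Omega> d \<theta> \<omega>) =
     interior_product scaleW \<iota> \<Omega> d \<theta> (lie_derivative scaleW \<iota> \<Omega> d \<phi> \<omega>) +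
     interior_product scaleW \<iota> \<Omega> d (commutator \<phi> \<theta>) \<omega>"
proof -
  interpret differential_calculus scaleA scaleW \<iota> \<Omega> d by fact
  \<comment> \<open>Closure of \<open>V\<close> under commutators is what provides an interior
    product \<open>j\<close> for the bracket.\<close>
  have "commutator \<phi> \<theta> \<in> V"
    using assms unfolding lie_space_of_derivations_def by blast
  with assms obtain L i j where
    "is_lie_derivative scaleW \<iota> \<Omega> d \<phi> L"
    "is_interior_product scaleW \<iota> \<Omega> d \<theta> i"
    "is_interior_product scaleW \<iota> \<Omega> d (commutator \<phi> \<theta>) j"
    by meson
  then show ?thesis
    by (simp add: interior_product_eq lie_derivative_eq lie_derivative_interior_product)
qed

end
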